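(* Let $\mu$ be any Borel probability measure on the unit circle $\mathcal{C}=\{z\in\mathbb{C}:|z|=1\}$, let $Z_1,Z_2,\dots$ be i.i.d. random variables with law $\mu$, and for $n\ge 2$ let $p_n(z)=(z-Z_1)(z-Z_2)\cdots(z-Z_n)$. Then the empirical distribution $\mathcal{Z}(p_n')$ of the critical points of $p_n$ converges weakly to $\mu$ in probability as $n\to\infty$; that is, for every bounded continuous function $f:\mathbb{C}\to\mathbb{C}$, $$\frac{1}{n-1}\sum_{j=1}^{n-1} f\big(y_j^{(n)}\big)\longrightarrow \int_{\mathcal{C}} f\,d\mu\quad\text{in probability},$$ where $y_1^{(n)},\dots,y_{n-1}^{(n)}$ are the roots of $p_n'$.
   Context: For a (random) polynomial $g$ with roots $X_1,\dots,X_m$, listed with multiplicity, $\mathcal{Z}(g)=\frac1m\sum_{j=1}^m\delta_{X_j}$ is the empirical distribution of its roots, a random probability measure on $\mathbb{C}$. In particular $\mathcal{Z}(p_n')=\frac{1}{n-1}\sum_{j=1}^{n-1}\delta_{y_j^{(n)}}$, where $y_1^{(n)},\dots,y_{n-1}^{(n)}$ are the roots of $p_n'$ counted with multiplicity. *)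

theory Defs
  imports "HOL-Probability.Probability"
    "HOL-Computational_Algebra.Fundamental_Theorem_Algebra"
begin

text \<open>
  The empirical distribution of the roots of a complex polynomial, counted with multiplicity,
  as a Borel measure on the plane. It is meaningful only for polynomials of positive degree;
  for constant polynomials it is an unspecified probability measure.
\<close>

definition root_measure :: "complex poly \<Rightarrow> complex measure" where
  "root_measure g = distr (measure_pmf (pmf_of_multiset (proots g))) borel (\<lambda>x. x)"

lemma sets_root_measure [simp]: "sets (root_measure g) = sets borel"
  by (simp add: root_measure_def)

lemma prob_space_root_measure: "prob_space (root_measure g)"
  unfolding root_measure_def by (rule measure_pmf.prob_space_distr) simp

lemma sum_mset_conv_count:
  fixes f :: "'a \<Rightarrow> complex"
  shows "(\<Sum>x\<in>#A. f x) = (\<Sum>x\<in>set_mset A. of_nat (count A x) * f x)"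
proof (induction A)
  case (add a A)
  have "(\<Sum>x\<in>set_mset (add_mset a A). of_nat (count (add_mset a A) x) * f x) =
        (\<Sum>x\<in>insert a (set_mset A). of_nat (count A x) * f x + (if x = a then f a else 0))"
    by (intro sum.cong) (auto simp: algebra_simps)
  also have "\<dots> = (\<Sum>x\<in>insert a (set_mset A). of_nat (count A x) * f x) + f a"
    by (simp add: sum.distrib)
  also have "(\<Sum>x\<in>insert a (set_mset A). of_nat (count A x) * f x) =
             (\<Sum>x\<in>set_mset A. of_nat (count A x) * f x)"
    by (rule sum.mono_neutral_right) (auto simp: not_in_iff)
  finally show ?case using add.IH by simp
qed simp

lemma integral_root_measure:
  fixes g :: "complex poly" and f :: "complex \<Rightarrow> complex"
  assumes deg: "degree g > 0" and f: "f \<in> borel_measurable borel"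
  shows "(\<integral>x. f x \<partial>root_measure g) = (\<Sum>x\<in>#proots g. f x) / of_nat (degree g)"
proof -
  have ne: "proots g \<noteq> {#}"
    using deg size_proots_complex[of g] by auto
  have "(\<integral>x. f x \<partial>root_measure g) = (\<integral>x. f x \<partial>measure_pmf (pmf_of_multiset (proots g)))"
    unfolding root_measure_def using f by (subst integral_distr) auto
  also have "\<dots> = (\<Sum>x\<in>set_mset (proots g). pmf (pmf_of_multiset (proots g)) x *\<^sub>R f x)"
    by (rule integral_measure_pmf) (auto simp: set_pmf_of_multiset[OF ne])
  also have "\<dots> = (\<Sum>x\<in>set_mset (proots g). of_nat (count (proots g) x) * f x) / of_nat (degree g)"
    by (simp add: pmf_of_multiset[OF ne] size_proots_complex scaleR_conv_of_real sum_divide_distrib)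
  also have "\<dots> = (\<Sum>x\<in>#proots g. f x) / of_nat (degree g)"
    by (simp add: sum_mset_conv_count)
  finally show ?thesis .
qed

definition root_poly :: "(nat \<Rightarrow> complex) \<Rightarrow> nat \<Rightarrow> complex poly" where
  "root_poly z n = (\<Prod>i=1..n. [:- z i, 1:])"

lemma poly_root_poly: "poly (root_poly z n) x = (\<Prod>i=1..n. x - z i)"
  by (simp add: root_poly_def poly_prod)

lemma degree_pderiv_root_poly: "degree (pderiv (root_poly z n)) = n - 1"
  by (simp add: root_poly_def degree_pderiv degree_prod_sum_eq)

text \<open>
  Convergence in probability to a constant. Measurability of the \<open>X n\<close> is part of the notion:
  without it the measure of the exceptional set could be \<open>0\<close> merely by convention.
\<close>

definition tendsto_in_prob ::
  "'w measure \<Rightarrow> (nat \<Rightarrow> 'w \<Rightarrow> 'b::metric_space) \<Rightarrow> 'b \<Rightarrow> bool" where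
  "tendsto_in_prob M X c \<longleftrightarrow>
     (\<forall>n. X n \<in> borel_measurable M) \<and>
     (\<forall>\<epsilon>>0. (\<lambda>n. measure M {\<omega> \<in> space M. dist (X n \<omega>) c > \<epsilon>}) \<longlonglongrightarrow> 0)"

definition weakly_tendsto_in_prob ::
  "'w measure \<Rightarrow> (nat \<Rightarrow> 'w \<Rightarrow> complex measure) \<Rightarrow> complex measure \<Rightarrow> bool" where
  "weakly_tendsto_in_prob M N \<mu> \<longleftrightarrow>
     (\<forall>f :: complex \<Rightarrow> complex. continuous_on UNIV f \<longrightarrow> bounded (range f) \<longrightarrow>
        tendsto_in_prob M (\<lambda>n \<omega>. \<integral>x. f x \<partial>N n \<omega>) (\<integral>x. f x \<partial>\<mu>))"

end

theory Submission
  imports Defs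
    "HOL-Computational_Algebra.Polynomial_FPS"
    "HOL-Real_Asymp.Real_Asymp"
begin

text \<open>
  The proof compares the critical points \<open>y\<^sub>j\<close> with the roots \<open>Z\<^sub>i\<close> themselves, whose empirical
  measure converges to \<open>\<mu>\<close> by the law of large numbers. Two facts make the two empirical
  measures close.

  First, holomorphic moments agree: taking the logarithmic derivative of
  \<open>p' = p \<cdot> \<Sum> 1 / (x - Z\<^sub>i)\<close> shows that the power sums \<open>\<Sum> Z\<^sub>i^k\<close> and \<open>\<Sum> y\<^sub>j^k\<close> differ by
  at most \<open>2^k\<close>, whatever \<open>n\<close> is (\<open>power_sum_critical_bound\<close>). This alone does not determine a
  measure on the disc, but it does so for measures on the circle, where \<open>cnj z = 1 / z\<close>.

  Second, the critical points, which lie in the closed disc by Gauss-Lucas, accumulate at the circle.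
  Evaluating \<open>p'\<close> at the single point \<open>0\<close> gives \<open>\<Prod> |y\<^sub>j| = |\<Sum> Z\<^sub>i| / n\<close>, so if
  \<open>|\<Sum> Z\<^sub>i| \<ge> 1\<close> then \<open>\<Sum> (1 - |y\<^sub>j|) \<le> \<Sum> - ln |y\<^sub>j| \<le> ln n\<close> (\<open>sum_deficit_le_ln\<close>), and
  the mean distance from the circle is \<open>O(ln n / n)\<close>.

  Hence for monomials \<open>z^a (cnj z)^b\<close>, and by the Stone-Weierstrass theorem for all continuous
  functions, the averages over roots and over critical points are close as soon as
  \<open>|\<Sum> Z\<^sub>i| \<ge> 1\<close> (\<open>critical_average_close_to_root_average\<close>). All randomness is now in the sum of
  the roots, and the probability that \<open>|\<Sum> Z\<^sub>i| < 1\<close> tends to \<open>0\<close>: by the law of large numbers if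
  \<open>\<mu>\<close> has nonzero mean, and by the central limit theorem if it is centred
  (\<open>prob_small_sum_tendsto_0\<close>).

  Convergence in probability includes measurability of the averages over the critical points. It
  follows from their continuity in the roots of \<open>p\<close> (\<open>continuous_integral_root_measure\<close>).
\<close>

section \<open>Critical points and the product of their moduli\<close>

text \<open>
  Numbering the critical points, with multiplicity, by \<open>j < n - 1\<close> turns sums over the multiset
  of roots of the derivative into indexed sums, and lets numberings converge coordinatewise.
\<close>

definition critical_enum :: "(nat \<Rightarrow> complex) \<Rightarrow> nat \<Rightarrow> (nat \<Rightarrow> complex) \<Rightarrow> bool" where
  "critical_enum z n y \<longleftrightarrow>
     pderiv (root_poly z n) = smult (of_nat n) (\<Prod>j<n-1. [:- y j, 1:])"

lemma critical_enum_exists: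
  assumes "n \<ge> 1"
  obtains y where "critical_enum z n y"
proof -
  let ?q = "pderiv (root_poly z n)"
  have deg: "degree (root_poly z n) = n"
    by (simp add: root_poly_def degree_prod_sum_eq)
  have "lead_coeff (root_poly z n) = 1"
    by (simp add: root_poly_def lead_coeff_prod)
  hence "lead_coeff ?q = of_nat n"
    using assms deg by (simp add: degree_pderiv coeff_pderiv)
  moreover obtain y where "smult (lead_coeff ?q) (\<Prod>j<degree ?q. [:- y j, 1:]) = ?q"
    by (rule complex_poly_decompose')
  ultimately have "critical_enum z n y"
    by (simp add: critical_enum_def degree_pderiv_root_poly)
  thus thesis by (rule that)
qed

lemma integral_critical_enum:
  fixes f :: "complex \<Rightarrow> complex"
  assumes y: "critical_enum z n y" and n: "n \<ge> 2" and f: "f \<in> borel_measurable borel"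
  shows "(\<integral>x. f x \<partial>root_measure (pderiv (root_poly z n))) = (\<Sum>j<n-1. f (y j)) / of_nat (n - 1)"
proof -
  have "proots (pderiv (root_poly z n)) = (\<Sum>j<n-1. proots [:- y j, 1:])"
    using y n by (simp add: critical_enum_def proots_prod)
  also have "\<dots> = image_mset y (mset_set {..<n-1})"
    by (simp add: sum_multiset_singleton sum_unfold_sum_mset)
  finally show ?thesis
    using integral_root_measure[OF _ f, of "pderiv (root_poly z n)"] n
    by (simp add: degree_pderiv_root_poly sum_unfold_sum_mset image_mset.compositionality o_def)
qed

lemma poly_pderiv_root_poly:
  "poly (pderiv (root_poly z n)) x = (\<Sum>i=1..n. \<Prod>l\<in>{1..n}-{i}. x - z l)"
  by (simp add: root_poly_def pderiv_prod poly_sum poly_prod pderiv_pCons)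

lemma critical_enum_poly:
  assumes "critical_enum z n y"
  shows "of_nat n * (\<Prod>j<n-1. x - y j) = (\<Sum>i=1..n. \<Prod>l\<in>{1..n}-{i}. x - z l)"
proof -
  have "poly (pderiv (root_poly z n)) x = of_nat n * (\<Prod>j<n-1. x - y j)"
    using assms by (simp add: critical_enum_def poly_prod)
  thus ?thesis by (simp add: poly_pderiv_root_poly)
qed

lemma critical_enumI:
  assumes "\<And>x. of_nat n * (\<Prod>j<n-1. x - y j) = (\<Sum>i=1..n. \<Prod>l\<in>{1..n}-{i}. x - z l)"
  shows "critical_enum z n y"
proof -
  have "poly (pderiv (root_poly z n)) = poly (smult (of_nat n) (\<Prod>j<n-1. [:- y j, 1:]))"
    by (rule ext, subst poly_pderiv_root_poly, subst assms[symmetric]) (simp add: poly_prod)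
  thus ?thesis by (simp add: critical_enum_def poly_eq_poly_eq_iff)
qed

text \<open>
  If \<open>x\<close> lies outside the disc, each \<open>x / (x - z\<^sub>i)\<close> has positive real part, so the logarithmic
  derivative \<open>\<Sum> 1 / (x - z\<^sub>i)\<close> does not vanish at \<open>x\<close>, and neither does the derivative.
\<close>

lemma Gauss_Lucas_cball:
  assumes y: "critical_enum z n y" and z: "\<And>i. i \<in> {1..n} \<Longrightarrow> norm (z i) \<le> R"
    and j: "j < n - 1"
  shows "norm (y j) \<le> R"
proof (rule ccontr)
  define x where "x = y j"
  assume "\<not> norm (y j) \<le> R"
  hence x: "norm x > R" by (simp add: x_def)
  have nz: "x - z i \<noteq> 0" if "i \<in> {1..n}" for i
    using x z[OF that] by auto
  have pos: "Re (x / (x - z i)) > 0" if "i \<in> {1..n}" for i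
  proof -
    \<comment> \<open>\<open>x / (x - z\<^sub>i)\<close> has the sign of \<open>Re (x * cnj (x - z\<^sub>i)) = |x|^2 - Re (cnj x * z\<^sub>i)\<close>.\<close>
    have "norm (z i) < norm x" using x z[OF that] by linarith
    hence "Re (cnj x * z i) < (norm x)\<^sup>2"
      by (smt (verit) complex_Re_le_cmod complex_mod_cnj mult_strict_left_mono norm_ge_zero
          norm_mult power2_eq_square)
    hence "Re (x * cnj (x - z i)) > 0"
      unfolding cmod_power2 by (simp add: algebra_simps power2_eq_square)
    moreover have "x / (x - z i) = x * cnj (x - z i) / of_real ((norm (x - z i))\<^sup>2)"
      by (rule complex_div_cnj)
    ultimately show ?thesis using nz[OF that]
      by (simp del: of_real_power)
  qed
  have "0 = (\<Sum>i=1..n. \<Prod>l\<in>{1..n}-{i}. x - z l)"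
    unfolding critical_enum_poly[OF y, symmetric] using j by (auto simp: x_def)
  also have "\<dots> = (\<Sum>i=1..n. (\<Prod>l=1..n. x - z l) / (x - z i))"
    using nz by (intro sum.cong) (auto simp: prod.remove)
  finally have "(\<Prod>l=1..n. x - z l) * (\<Sum>i=1..n. 1 / (x - z i)) = 0"
    by (simp add: sum_distrib_left)
  moreover have "(\<Prod>l=1..n. x - z l) \<noteq> 0" using nz by simp
  ultimately have "Re (x * (\<Sum>i=1..n. 1 / (x - z i))) = 0" by simp
  hence "(\<Sum>i=1..n. Re (x / (x - z i))) = 0" by (simp add: sum_distrib_left)
  moreover have "(\<Sum>i=1..n. Re (x / (x - z i))) > 0"
    using pos j by (intro sum_pos) auto
  ultimately show False by simp
qed

text \<open>
  Both sides are \<open>|p'(0)|\<close>: the left one from the roots of the derivative, the right one because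
  \<open>p'(0) = \<plusminus>(\<Prod> z\<^sub>i) (\<Sum> 1 / z\<^sub>i)\<close> and \<open>1 / z\<^sub>i = cnj z\<^sub>i\<close> on the circle.
\<close>

lemma prod_norm_critical:
  assumes y: "critical_enum z n y" and z: "\<And>i. i \<in> {1..n} \<Longrightarrow> norm (z i) = 1"
  shows "real n * (\<Prod>j<n-1. norm (y j)) = norm (\<Sum>i=1..n. z i)"
proof -
  have nz: "z i \<noteq> 0" if "i \<in> {1..n}" for i using z[OF that] by auto
  have "real n * (\<Prod>j<n-1. norm (y j)) = norm (of_nat n * (\<Prod>j<n-1. 0 - y j))"
    by (simp add: norm_mult flip: prod_norm)
  also have "of_nat n * (\<Prod>j<n-1. 0 - y j) = (\<Sum>i=1..n. \<Prod>l\<in>{1..n}-{i}. 0 - z l)"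
    by (rule critical_enum_poly[OF y])
  also have "\<dots> = (\<Sum>i=1..n. (\<Prod>l=1..n. 0 - z l) * - cnj (z i))"
  proof (intro sum.cong refl)
    fix i assume i: "i \<in> {1..n}"
    have "z i * cnj (z i) = 1" using z[OF i] by (simp add: complex_norm_square[symmetric])
    thus "(\<Prod>l\<in>{1..n}-{i}. 0 - z l) = (\<Prod>l=1..n. 0 - z l) * - cnj (z i)"
      using i by (subst (2) prod.remove[of _ i]) (auto simp: algebra_simps)
  qed
  also have "\<dots> = - (\<Prod>l=1..n. 0 - z l) * cnj (\<Sum>i=1..n. z i)"
    by (simp add: sum_distrib_left sum_negf)
  also have "norm \<dots> = norm (\<Sum>i=1..n. z i)"
    using z by (simp add: norm_mult prod_norm[symmetric] del: cnj_sum)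
  finally show ?thesis .
qed

text \<open>
  Since \<open>1 - r \<le> - ln r\<close>, the total distance of the critical points from the circle is controlled
  by their product. As there are \<open>n - 1\<close> of them, the bound \<open>ln n\<close> says that their mean distance
  from the circle is small.
\<close>

lemma sum_deficit_le_ln:
  assumes y: "critical_enum z n y" and z: "\<And>i. i \<in> {1..n} \<Longrightarrow> norm (z i) = 1"
    and S: "norm (\<Sum>i=1..n. z i) \<ge> 1" and n: "n \<ge> 1"
  shows "(\<Sum>j<n-1. 1 - norm (y j)) \<le> ln n"
proof -
  have eq: "real n * (\<Prod>j<n-1. norm (y j)) \<ge> 1"
    using prod_norm_critical[OF y z] S by simp
  have "(\<Prod>j<n-1. norm (y j)) \<noteq> 0"
    using eq by (metis mult_zero_right not_one_le_zero)
  hence nz: "\<forall>j<n-1. y j \<noteq> 0" by simp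
  have "(\<Sum>j<n-1. 1 - norm (y j)) \<le> (\<Sum>j<n-1. - ln (norm (y j)))"
    using nz by (intro sum_mono) (smt (verit) lessThan_iff ln_le_minus_one zero_less_norm_iff)
  also have "\<dots> = - ln (\<Prod>j<n-1. norm (y j))"
    using nz by (subst ln_prod) (auto simp: sum_negf)
  also have "\<dots> \<le> ln n"
  proof -
    have "0 \<le> ln (real n * (\<Prod>j<n-1. norm (y j)))" using eq by simp
    also have "\<dots> = ln n + ln (\<Prod>j<n-1. norm (y j))"
      using n nz by (intro ln_mult_pos) (auto intro!: prod_pos)
    finally show ?thesis by simp
  qed
  finally show ?thesis .
qed

section \<open>Power sums of roots and of critical points\<close>

unbundle no vec_syntax
unbundle fps_syntax

text \<open>
  The reversed polynomial \<open>\<Prod> (1 - w\<^sub>i X)\<close>, whose logarithmic derivative generates the power sums.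
\<close>

definition root_fps :: "('i \<Rightarrow> complex) \<Rightarrow> 'i set \<Rightarrow> complex fps" where
  "root_fps w I = (\<Prod>i\<in>I. 1 - fps_const (w i) * fps_X)"

definition power_sum_fps :: "('i \<Rightarrow> complex) \<Rightarrow> 'i set \<Rightarrow> complex fps" where
  "power_sum_fps w I = Abs_fps (\<lambda>k. \<Sum>i\<in>I. w i ^ k)"

lemma geometric_fps: "(1 - fps_const a * fps_X) * Abs_fps (\<lambda>k. a ^ k) = (1 :: complex fps)"
proof (rule fps_ext)
  fix n show "((1 - fps_const a * fps_X) * Abs_fps (\<lambda>k. a ^ k)) $ n = (1 :: complex fps) $ n"
    by (cases n) (simp_all add: left_diff_distrib mult.assoc)
qed

lemma power_sum_fps_eq_sum: "power_sum_fps w I = (\<Sum>i\<in>I. Abs_fps (\<lambda>k. w i ^ k))"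
  by (rule fps_ext) (simp add: power_sum_fps_def fps_sum_nth)

lemma root_fps_times_power_sum:
  assumes "finite I"
  shows "root_fps w I * power_sum_fps w I = (\<Sum>i\<in>I. root_fps w (I - {i}))"
  unfolding power_sum_fps_eq_sum sum_distrib_left
proof (intro sum.cong refl)
  fix i assume i: "i \<in> I"
  have "root_fps w I = (1 - fps_const (w i) * fps_X) * root_fps w (I - {i})"
    unfolding root_fps_def using assms i by (rule prod.remove)
  hence "root_fps w I * Abs_fps (\<lambda>k. w i ^ k) =
      ((1 - fps_const (w i) * fps_X) * Abs_fps (\<lambda>k. w i ^ k)) * root_fps w (I - {i})"
    by (simp add: mult_ac)
  thus "root_fps w I * Abs_fps (\<lambda>k. w i ^ k) = root_fps w (I - {i})"
    by (simp only: geometric_fps mult_1)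
qed

text \<open>
  Newton's identities as \<open>X A' = (card I - S) A\<close>, with \<open>A\<close> the reversed polynomial and \<open>S\<close>
  the series of power sums.
\<close>

lemma Newton_identity_fps:
  assumes "finite I"
  shows "fps_X * fps_deriv (root_fps w I) =
           of_nat (card I) * root_fps w I - root_fps w I * power_sum_fps w I"
  using assms
proof (induction I)
  case empty
  show ?case by (simp add: root_fps_def power_sum_fps_eq_sum)
next
  case (insert a I)
  define u where "u = 1 - fps_const (w a) * fps_X"
  define E where "E = Abs_fps (\<lambda>k. w a ^ k)"
  define F where "F = root_fps w I"
  define G where "G = power_sum_fps w I"
  have uE: "u * E = 1" unfolding u_def E_def by (rule geometric_fps)
  have ins: "root_fps w (insert a I) = u * F" "power_sum_fps w (insert a I) = E + G"
    using insert.hyps by (simp_all add: root_fps_def power_sum_fps_eq_sum u_def E_def F_def G_def)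
  have du: "fps_X * fps_deriv u = u - 1" by (simp add: u_def)
  have "fps_X * fps_deriv (u * F) = (fps_X * fps_deriv u) * F + u * (fps_X * fps_deriv F)"
    by (simp add: algebra_simps)
  also have "\<dots> = (u - 1) * F + u * (of_nat (card I) * F - F * G)"
    using insert.IH by (simp only: du F_def G_def)
  also have "\<dots> = of_nat (Suc (card I)) * (u * F) - u * F * (E + G)"
  proof -
    have "u * F * (E + G) = (u * E) * F + u * F * G" by (simp add: algebra_simps)
    thus ?thesis unfolding uE by (simp add: algebra_simps)
  qed
  finally show ?case using insert.hyps by (simp add: ins)
qed

text \<open>
  The identity \<open>p' = p \<cdot> \<Sum> 1 / (x - z\<^sub>i)\<close> after the substitution \<open>x = 1 / t\<close> and multiplication
  by \<open>t ^ (n - 1)\<close>.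
\<close>

lemma critical_enum_root_fps:
  assumes y: "critical_enum z n y"
  shows "of_nat n * root_fps y {..<n-1} = root_fps z {1..n} * power_sum_fps z {1..n}"
proof -
  have fps: "root_fps w I = fps_of_poly (\<Prod>i\<in>I. [:1, - w i:])" for w :: "nat \<Rightarrow> complex" and I
    by (simp add: root_fps_def fps_of_poly_prod fps_of_poly_pCons fps_of_poly_const mult.commute
        flip: fps_const_neg)
  have eval: "of_nat n * (\<Prod>j<n-1. 1 - y j * t) = (\<Sum>i=1..n. \<Prod>l\<in>{1..n}-{i}. 1 - z l * t)"
    for t :: complex
  proof (cases "t = 0")
    case False
    have "of_nat n * (\<Prod>j<n-1. 1 - y j * t) = t ^ (n - 1) * (of_nat n * (\<Prod>j<n-1. 1 / t - y j))"
    proof -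
      have "(\<Prod>j<n-1. 1 - y j * t) = (\<Prod>j<n-1. t * (1 / t - y j))"
        using False by (intro prod.cong) (auto simp: field_simps)
      thus ?thesis by (simp add: prod.distrib)
    qed
    also have "\<dots> = t ^ (n - 1) * (\<Sum>i=1..n. \<Prod>l\<in>{1..n}-{i}. 1 / t - z l)"
      by (subst critical_enum_poly[OF y]) simp
    also have "\<dots> = (\<Sum>i=1..n. \<Prod>l\<in>{1..n}-{i}. 1 - z l * t)"
      unfolding sum_distrib_left
    proof (intro sum.cong refl)
      fix i assume i: "i \<in> {1..n}"
      have "(\<Prod>l\<in>{1..n}-{i}. 1 - z l * t) = (\<Prod>l\<in>{1..n}-{i}. t * (1 / t - z l))"
        using False by (intro prod.cong) (auto simp: field_simps)
      also have "\<dots> = t ^ (n - 1) * (\<Prod>l\<in>{1..n}-{i}. 1 / t - z l)"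
        using i by (simp add: prod.distrib)
      finally show "t ^ (n - 1) * (\<Prod>l\<in>{1..n}-{i}. 1 / t - z l) = (\<Prod>l\<in>{1..n}-{i}. 1 - z l * t)" ..
    qed
    finally show ?thesis .
  qed simp
  have "poly (smult (of_nat n) (\<Prod>j<n-1. [:1, - y j:])) =
        poly (\<Sum>i=1..n. \<Prod>l\<in>{1..n}-{i}. [:1, - z l:])"
    using eval by (simp add: fun_eq_iff poly_prod poly_sum mult.commute)
  hence "smult (of_nat n) (\<Prod>j<n-1. [:1, - y j:]) = (\<Sum>i=1..n. \<Prod>l\<in>{1..n}-{i}. [:1, - z l:])"
    by (simp only: poly_eq_poly_eq_iff)
  from arg_cong[OF this, of fps_of_poly] show ?thesis
    by (subst root_fps_times_power_sum)
       (simp_all add: fps fps_of_poly_smult fps_of_poly_sum fps_of_nat)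
qed

text \<open>
  The logarithmic derivative of \<open>n B = A S\<close>, where \<open>A\<close> and \<open>B\<close> are the reversed polynomials of the
  roots and of the critical points: Newton's identities turn \<open>X A' / A\<close> into \<open>n - S\<close> and
  \<open>X B' / B\<close> into \<open>n - 1 - T\<close>, so that \<open>n - 1 - T = n - S + X S' / S\<close>.
\<close>

lemma critical_power_sum_fps:
  assumes y: "critical_enum z n y" and n: "n \<ge> 1"
  defines "S \<equiv> power_sum_fps z {1..n}" and "T \<equiv> power_sum_fps y {..<n-1}"
  shows "(S - 1 - T) * S = fps_X * fps_deriv S"
proof -
  define A where "A = root_fps z {1..n}"
  define B where "B = root_fps y {..<n-1}"
  have AB: "of_nat n * B = A * S"
    unfolding A_def B_def S_def by (rule critical_enum_root_fps[OF y])
  have dA: "fps_X * fps_deriv A = of_nat n * A - A * S"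
    unfolding A_def S_def by (subst Newton_identity_fps) auto
  have dB: "fps_X * fps_deriv B = (of_nat n - 1) * B - B * T"
    unfolding B_def T_def using n by (subst Newton_identity_fps) (auto simp: of_nat_diff)
  have "fps_X * fps_deriv (of_nat n * B) = of_nat n * (fps_X * fps_deriv B)"
    by (simp add: algebra_simps)
  also have "\<dots> = (of_nat n - 1) * (of_nat n * B) - (of_nat n * B) * T"
    unfolding dB by (simp add: algebra_simps)
  finally have 1: "fps_X * fps_deriv (A * S) = (of_nat n - 1) * (A * S) - (A * S) * T"
    unfolding AB .
  have "fps_X * fps_deriv (A * S) = (fps_X * fps_deriv A) * S + A * (fps_X * fps_deriv S)"
    by (simp add: algebra_simps)
  hence 2: "fps_X * fps_deriv (A * S) = (of_nat n * A - A * S) * S + A * (fps_X * fps_deriv S)"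
    unfolding dA .
  have "A * ((S - 1 - T) * S - fps_X * fps_deriv S) = 0"
    using trans[OF 1[symmetric] 2] by (simp add: algebra_simps)
  moreover have "A $ 0 = 1" 
    unfolding A_def root_fps_def by (induction n) simp_all
  hence "A \<noteq> 0" by auto
  ultimately show ?thesis by simp
qed

text \<open>
  Put \<open>D = S - 1 - T\<close>. All coefficients of \<open>S\<close> are at most \<open>n = S\<^sub>0\<close> in modulus, so solving
  \<open>D S = X S'\<close> for the coefficients of \<open>D\<close> gives a recursion in which \<open>n\<close> cancels. The point is
  that the bound does not depend on \<open>n\<close>: after division by \<open>n\<close>, roots and critical points have
  asymptotically the same moments \<open>\<integral> z^k\<close>.
\<close>

lemma power_sum_critical_bound:
  assumes y: "critical_enum z n y" and n: "n \<ge> 1"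
    and z: "\<And>i. i \<in> {1..n} \<Longrightarrow> norm (z i) \<le> 1"
  shows "norm ((\<Sum>i=1..n. z i ^ k) - (\<Sum>j<n-1. y j ^ k)) \<le> 2 ^ k"
proof -
  define S where "S = power_sum_fps z {1..n}"
  define T where "T = power_sum_fps y {..<n-1}"
  define D where "D = S - 1 - T"
  have S0: "S $ 0 = of_nat n" and D0: "D $ 0 = 0"
    using n by (simp_all add: S_def T_def D_def power_sum_fps_def of_nat_diff)
  have S: "norm (S $ k) \<le> n" for k
  proof -
    have "norm (S $ k) \<le> (\<Sum>i=1..n. norm (z i ^ k))"
      unfolding S_def power_sum_fps_def by (simp add: sum_norm_le)
    also have "\<dots> \<le> (\<Sum>i=1..n. 1)"
      using z by (intro sum_mono) (auto simp: norm_power power_le_one)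
    finally show ?thesis by simp
  qed
  have DS: "D * S = fps_X * fps_deriv S"
    unfolding D_def S_def T_def by (rule critical_power_sum_fps[OF y n])
  have rec: "of_nat n * D $ k = of_nat k * S $ k - (\<Sum>i<k. D $ i * S $ (k - i))" for k
  proof -
    have "(D * S) $ k = (\<Sum>i<k. D $ i * S $ (k - i)) + D $ k * S $ 0"
      by (simp add: fps_mult_nth atLeast0AtMost flip: lessThan_Suc_atMost)
    moreover have "(D * S) $ k = of_nat k * S $ k"
      unfolding DS by (cases k) simp_all
    ultimately show ?thesis by (simp add: S0 algebra_simps)
  qed
  \<comment> \<open>\<open>2 ^ k - 1\<close> is the solution of \<open>c\<^sub>k = k + (\<Sum>i<k. c\<^sub>i)\<close>, the recursion for the bounds.\<close>
  have geo: "(\<Sum>i<k. 2 ^ i - 1 :: real) = 2 ^ k - 1 - real k" for k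
    by (induction k) auto
  have bound: "norm (D $ k) \<le> 2 ^ k - 1" for k
  proof (induction k rule: less_induct)
    case (less k)
    have "real n * norm (D $ k) = norm (of_nat k * S $ k - (\<Sum>i<k. D $ i * S $ (k - i)))"
      unfolding rec[symmetric] by (simp add: norm_mult)
    also have "\<dots> \<le> real k * norm (S $ k) + (\<Sum>i<k. norm (D $ i) * norm (S $ (k - i)))"
      by (rule order.trans[OF norm_triangle_ineq4])
         (auto simp: norm_mult intro!: add_mono sum_norm_le)
    also have "\<dots> \<le> real k * real n + (\<Sum>i<k. (2 ^ i - 1) * real n)"
    proof (rule add_mono)
      show "real k * norm (S $ k) \<le> real k * real n"
        using S by (rule mult_left_mono) simp
      show "(\<Sum>i<k. norm (D $ i) * norm (S $ (k - i))) \<le> (\<Sum>i<k. (2 ^ i - 1) * real n)"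
        using less S by (intro sum_mono mult_mono) (simp_all add: one_le_power)
    qed
    also have "\<dots> = n * (2 ^ k - 1)"
      unfolding sum_distrib_right[symmetric] geo by (simp add: algebra_simps)
    finally show ?case using n by simp
  qed
  have "(\<Sum>i=1..n. z i ^ k) - (\<Sum>j<n-1. y j ^ k) = D $ k + (if k = 0 then 1 else 0)"
    by (simp add: D_def S_def T_def power_sum_fps_def)
  also have "norm \<dots> \<le> norm (D $ k) + 1"
    by (rule order.trans[OF norm_triangle_ineq]) auto
  finally show ?thesis using bound[of k] by simp
qed

unbundle no fps_syntax
unbundle vec_syntax

section \<open>Averages over critical points and averages over roots\<close>

text \<open>
  Complex polynomials in \<open>z\<close> and its conjugate, presented as sums of monomials because the
  comparison of averages below is additive but not multiplicative.
\<close>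

inductive bipoly :: "(complex \<Rightarrow> complex) \<Rightarrow> bool" where
  monomial: "bipoly (\<lambda>z. c * z ^ a * cnj z ^ b)"
| add: "bipoly f \<Longrightarrow> bipoly g \<Longrightarrow> bipoly (\<lambda>z. f z + g z)"

lemma bipoly_const: "bipoly (\<lambda>z. c)"
  using bipoly.monomial[of c 0 0] by simp

lemma bipoly_mult:
  assumes "bipoly f" "bipoly g"
  shows "bipoly (\<lambda>z. f z * g z)"
  using assms(1)
proof induction
  case (monomial c a b)
  from assms(2) show ?case
  proof induction
    case (monomial c' a' b')
    have "(\<lambda>z. (c * z ^ a * cnj z ^ b) * (c' * z ^ a' * cnj z ^ b')) =
          (\<lambda>z. (c * c') * z ^ (a + a') * cnj z ^ (b + b'))"
      by (simp add: fun_eq_iff power_add)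
    thus ?case using bipoly.monomial[of "c * c'" "a + a'" "b + b'"] by simp
  next
    case (add g h)
    thus ?case using bipoly.add by (simp add: distrib_left)
  qed
next
  case (add f h)
  thus ?case using bipoly.add by (simp add: distrib_right)
qed

lemma bipoly_linear:
  fixes f :: "complex \<Rightarrow> real"
  assumes "bounded_linear f"
  shows "bipoly (\<lambda>z. of_real (f z))"
proof -
  have f: "f z = Re z * f 1 + Im z * f \<i>" for z
  proof -
    interpret bounded_linear f by fact
    have "f z = f (Re z *\<^sub>R 1 + Im z *\<^sub>R \<i>)"
      by (rule arg_cong[of _ _ f]) (simp add: complex_eq_iff)
    thus ?thesis by (simp add: add scale)
  qed
  define u v where "u = (f 1 - \<i> * f \<i>) / 2" and "v = (f 1 + \<i> * f \<i>) / 2"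
  have "(\<lambda>z. of_real (f z)) = (\<lambda>z. u * z ^ 1 * cnj z ^ 0 + v * z ^ 0 * cnj z ^ 1)"
    by (rule ext, subst f) (simp add: u_def v_def complex_eq_iff field_simps)
  moreover have "bipoly (\<lambda>z. u * z ^ 1 * cnj z ^ 0 + v * z ^ 0 * cnj z ^ 1)"
    by (intro bipoly.intros)
  ultimately show ?thesis by simp
qed

lemma bipoly_real_polynomial_function:
  fixes f :: "complex \<Rightarrow> real"
  assumes "real_polynomial_function f"
  shows "bipoly (\<lambda>z. of_real (f z))"
  using assms
  by induction (auto intro: bipoly_linear bipoly_const bipoly.add bipoly_mult)

text \<open>
  The Stone-Weierstrass theorem: every real polynomial in the two coordinates of \<open>z\<close> is a
  polynomial in \<open>z\<close> and \<open>cnj z\<close>.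
\<close>

lemma bipoly_dense:
  fixes f :: "complex \<Rightarrow> complex"
  assumes "continuous_on K f" "compact K" "e > 0"
  obtains g where "bipoly g" "\<And>z. z \<in> K \<Longrightarrow> norm (f z - g z) < e"
proof -
  obtain g where g: "polynomial_function g" "\<And>z. z \<in> K \<Longrightarrow> norm (f z - g z) < e"
    using Stone_Weierstrass_polynomial_function[OF assms(2,1,3)] by blast
  have "real_polynomial_function (Re \<circ> g)" "real_polynomial_function (Im \<circ> g)"
    using g(1) bounded_linear_Re bounded_linear_Im unfolding polynomial_function_def by blast+
  hence "bipoly (\<lambda>z. of_real ((Re \<circ> g) z) + \<i> * of_real ((Im \<circ> g) z))"
    by (intro bipoly.add bipoly_mult bipoly_const bipoly_real_polynomial_function)
  hence "bipoly g" by (simp flip: complex_eq)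
  thus thesis using g(2) by (rule that)
qed

text \<open>
  The bound has the form that monomials produce: the term of order \<open>1 / n\<close> comes from the power
  sums, and the mean distance of the critical points from the circle comes from replacing
  \<open>|z|^2\<close> by \<open>1\<close>. What matters is that \<open>K\<close> does not depend on the polynomial.
\<close>

definition averages_comparable :: "(complex \<Rightarrow> complex) \<Rightarrow> real \<Rightarrow> bool" where
  "averages_comparable g K \<longleftrightarrow>
     (\<forall>n z y. n \<ge> 2 \<longrightarrow> critical_enum z n y \<longrightarrow> (\<forall>i\<in>{1..n}. norm (z i) = 1) \<longrightarrow>
        norm ((\<Sum>j<n-1. g (y j)) / of_nat (n - 1) - (\<Sum>i=1..n. g (z i)) / of_nat n)
          \<le> K * (1 + (\<Sum>j<n-1. 1 - norm (y j))) / real (n - 1))"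

text \<open>
  On the circle \<open>z^a (cnj z)^b\<close> is a pure power \<open>h\<close> of \<open>z\<close> or of \<open>cnj z\<close>. Inside the disc it
  differs from \<open>h\<close> by the factor \<open>|z|^(2m)\<close>, which costs at most \<open>2m (1 - |z|)\<close> by Bernoulli's
  inequality. The averages of \<open>h\<close> are compared by the bound on power sums.
\<close>

lemma averages_comparable_monomial:
  "averages_comparable (\<lambda>z. c * z ^ a * cnj z ^ b) (norm c * (2 ^ (a + b) + 1 + 2 * real (a + b)))"
  unfolding averages_comparable_def
proof (intro allI impI)
  fix n :: nat and z y :: "nat \<Rightarrow> complex"
  assume n: "n \<ge> 2" and y: "critical_enum z n y" and z: "\<forall>i\<in>{1..n}. norm (z i) = 1"
  define m where "m = min a b"
  define k where "k = max a b - m"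
  define h where "h w = (if b \<le> a then w ^ k else cnj w ^ k)" for w
  define d where "d = (\<Sum>j<n-1. 1 - norm (y j))"
  define Ag where "Ag = (\<Sum>j<n-1. y j ^ a * cnj (y j) ^ b)"
  define Ah where "Ah = (\<Sum>j<n-1. h (y j))"
  define B where "B = (\<Sum>i=1..n. h (z i))"
  have le1: "norm (y j) \<le> 1" if "j < n - 1" for j
    using Gauss_Lucas_cball[OF y _ that, of 1] z by simp
  have d0: "d \<ge> 0"
    unfolding d_def using le1 by (intro sum_nonneg) auto
  have factor: "w ^ a * cnj w ^ b = h w * of_real (norm w ^ (2 * m))" for w
  proof -
    have "of_real (norm w ^ (2 * m)) = (of_real ((norm w)\<^sup>2) :: complex) ^ m"
      by (simp add: power_mult)
    also have "\<dots> = w ^ m * cnj w ^ m"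
      by (simp only: complex_norm_square power_mult_distrib)
    finally have "of_real (norm w ^ (2 * m)) = w ^ m * cnj w ^ m" .
    moreover have "a = k + m \<and> b = m" if "b \<le> a" using that by (auto simp: m_def k_def)
    moreover have "b = k + m \<and> a = m" if "\<not> b \<le> a" using that by (auto simp: m_def k_def)
    ultimately show ?thesis by (auto simp: h_def power_add)
  qed
  have nh: "norm (h w) = norm w ^ k" for w
    by (simp add: h_def norm_power)
  have Bg: "(\<Sum>i=1..n. z i ^ a * cnj (z i) ^ b) = B"
    unfolding B_def using z by (intro sum.cong) (auto simp: factor)
  have "norm (Ag - Ah) \<le> (\<Sum>j<n-1. real (2 * m) * (1 - norm (y j)))"
    unfolding Ag_def Ah_def sum_subtractf[symmetric]
  proof (rule sum_norm_le)
    fix j assume "j \<in> {..<n-1}"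
    hence r: "norm (y j) \<le> 1" using le1 by simp
    have "y j ^ a * cnj (y j) ^ b - h (y j) = h (y j) * of_real (norm (y j) ^ (2 * m) - 1)"
      by (simp add: factor algebra_simps)
    hence "norm (y j ^ a * cnj (y j) ^ b - h (y j)) = norm (y j) ^ k * \<bar>norm (y j) ^ (2 * m) - 1\<bar>"
      by (simp only: norm_mult nh norm_of_real)
    also have "\<dots> \<le> 1 * \<bar>norm (y j) ^ (2 * m) - 1\<bar>"
      using r by (intro mult_right_mono power_le_one) auto
    also have "\<dots> = 1 - norm (y j) ^ (2 * m)"
      using r by (simp add: power_le_one)
    also have "\<dots> \<le> real (2 * m) * (1 - norm (y j))"
      using Bernoulli_inequality[of "norm (y j) - 1" "2 * m"] by (simp add: algebra_simps)
    finally show "norm (y j ^ a * cnj (y j) ^ b - h (y j)) \<le> real (2 * m) * (1 - norm (y j))" .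
  qed
  also have "\<dots> \<le> 2 * real (a + b) * d"
    unfolding sum_distrib_left[symmetric] d_def[symmetric] using d0
    by (intro mult_right_mono) (auto simp: m_def)
  finally have 1: "norm (Ag - Ah) \<le> 2 * real (a + b) * d" .
  have "norm (B - Ah) \<le> 2 ^ k"
  proof -
    have *: "norm ((\<Sum>i=1..n. z i ^ k) - (\<Sum>j<n-1. y j ^ k)) \<le> 2 ^ k"
      using power_sum_critical_bound[OF y] z n by simp
    have "cnj ((\<Sum>i=1..n. z i ^ k) - (\<Sum>j<n-1. y j ^ k)) =
        (\<Sum>i=1..n. cnj (z i) ^ k) - (\<Sum>j<n-1. cnj (y j) ^ k)"
      by simp
    with * have **: "norm ((\<Sum>i=1..n. cnj (z i) ^ k) - (\<Sum>j<n-1. cnj (y j) ^ k)) \<le> 2 ^ k"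
      by (metis complex_mod_cnj)
    show ?thesis
    proof (cases "b \<le> a")
      case True
      thus ?thesis using * by (simp add: B_def Ah_def h_def)
    next
      case False
      thus ?thesis using ** by (simp add: B_def Ah_def h_def)
    qed
  qed
  also have "(2::real) ^ k \<le> 2 ^ (a + b)"
    by (rule power_increasing) (auto simp: k_def)
  finally have 2: "norm (B - Ah) \<le> 2 ^ (a + b)" .
  have "norm B \<le> (\<Sum>i=1..n. 1)"
    unfolding B_def using z by (intro sum_norm_le) (auto simp: nh)
  hence 3: "norm (B / of_nat n) \<le> 1" using n by (simp add: norm_divide field_simps)
  have "Ag / of_nat (n - 1) - B / of_nat n = ((Ag - Ah) - (B - Ah) + B / of_nat n) / of_nat (n - 1)"
    using n by (simp add: field_simps of_nat_diff)
  also have "norm \<dots> = norm ((Ag - Ah) - (B - Ah) + B / of_nat n) / real (n - 1)"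
    by (simp add: norm_divide)
  also have "\<dots> \<le> (2 * real (a + b) * d + 2 ^ (a + b) + 1) / real (n - 1)"
    using norm_triangle_ineq[of "(Ag - Ah) - (B - Ah)" "B / of_nat n"]
      norm_triangle_ineq4[of "Ag - Ah" "B - Ah"] 1 2 3
    by (intro divide_right_mono) auto
  also have "\<dots> \<le> (2 ^ (a + b) + 1 + 2 * real (a + b)) * (1 + d) / real (n - 1)"
    using d0 by (intro divide_right_mono) (auto simp: algebra_simps)
  finally have main: "norm (Ag / of_nat (n - 1) - B / of_nat n)
      \<le> (2 ^ (a + b) + 1 + 2 * real (a + b)) * (1 + d) / real (n - 1)" .
  have "(\<Sum>j<n-1. c * y j ^ a * cnj (y j) ^ b) / of_nat (n - 1)
      - (\<Sum>i=1..n. c * z i ^ a * cnj (z i) ^ b) / of_nat n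
      = c * (Ag / of_nat (n - 1) - B / of_nat n)"
    unfolding Bg[symmetric] Ag_def
    by (simp add: sum_distrib_left mult.assoc right_diff_distrib)
  thus "norm ((\<Sum>j<n-1. c * y j ^ a * cnj (y j) ^ b) / of_nat (n - 1)
      - (\<Sum>i=1..n. c * z i ^ a * cnj (z i) ^ b) / of_nat n)
      \<le> norm c * (2 ^ (a + b) + 1 + 2 * real (a + b)) * (1 + (\<Sum>j<n-1. 1 - norm (y j))) / real (n - 1)"
    using mult_left_mono[OF main, of "norm c"] unfolding d_def[symmetric]
    by (simp add: norm_mult mult.assoc)
qed

lemma averages_comparable_bipoly:
  assumes "bipoly g"
  shows "\<exists>K\<ge>0. averages_comparable g K"
  using assms
proof induction
  case (monomial c a b)
  show ?case
    by (rule exI[of _ "norm c * (2 ^ (a + b) + 1 + 2 * real (a + b))"])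
       (simp add: averages_comparable_monomial[simplified])
next
  case (add f g)
  then obtain K L where K: "K \<ge> 0" "averages_comparable f K" and L: "L \<ge> 0" "averages_comparable g L"
    by blast
  have "averages_comparable (\<lambda>z. f z + g z) (K + L)"
    unfolding averages_comparable_def
  proof (intro allI impI)
    fix n :: nat and z y :: "nat \<Rightarrow> complex"
    assume *: "n \<ge> 2" "critical_enum z n y" "\<forall>i\<in>{1..n}. norm (z i) = 1"
    have "(\<Sum>j<n-1. f (y j) + g (y j)) / of_nat (n - 1) - (\<Sum>i=1..n. f (z i) + g (z i)) / of_nat n
        = ((\<Sum>j<n-1. f (y j)) / of_nat (n - 1) - (\<Sum>i=1..n. f (z i)) / of_nat n)
        + ((\<Sum>j<n-1. g (y j)) / of_nat (n - 1) - (\<Sum>i=1..n. g (z i)) / of_nat n)"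
      by (simp add: sum.distrib add_divide_distrib)
    also have "norm \<dots> \<le> K * (1 + (\<Sum>j<n-1. 1 - norm (y j))) / real (n - 1)
                      + L * (1 + (\<Sum>j<n-1. 1 - norm (y j))) / real (n - 1)"
      using K(2) L(2) * unfolding averages_comparable_def
      by (intro order.trans[OF norm_triangle_ineq] add_mono) blast+
    also have "\<dots> = (K + L) * (1 + (\<Sum>j<n-1. 1 - norm (y j))) / real (n - 1)"
      by (simp add: distrib_right add_divide_distrib)
    finally show "norm ((\<Sum>j<n-1. f (y j) + g (y j)) / of_nat (n - 1)
        - (\<Sum>i=1..n. f (z i) + g (z i)) / of_nat n)
        \<le> (K + L) * (1 + (\<Sum>j<n-1. 1 - norm (y j))) / real (n - 1)" .
  qed
  thus ?case using K(1) L(1) by (intro exI[of _ "K + L"]) simp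
qed

lemma norm_average_diff_le:
  fixes u v :: "'i \<Rightarrow> complex"
  assumes "\<And>i. i \<in> I \<Longrightarrow> norm (u i - v i) \<le> e" "e \<ge> 0"
  shows "norm ((\<Sum>i\<in>I. u i) / of_nat (card I) - (\<Sum>i\<in>I. v i) / of_nat (card I)) \<le> e"
proof -
  have "norm ((\<Sum>i\<in>I. u i - v i)) \<le> (\<Sum>i\<in>I. e)"
    using assms by (intro sum_norm_le)
  hence "norm ((\<Sum>i\<in>I. u i - v i)) \<le> real (card I) * e" by simp
  hence "norm ((\<Sum>i\<in>I. u i - v i) / of_nat (card I)) \<le> e"
    using assms(2) by (cases "card I = 0") (simp_all add: norm_divide field_simps)
  thus ?thesis by (simp add: sum_subtractf diff_divide_distrib)
qed

text \<open>
  No probability is involved: once the sum of the roots is not small, the critical points imitate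
  the roots, uniformly over all configurations on the circle. To see this, approximate \<open>f\<close>
  uniformly on the closed disc, which contains the critical points by Gauss-Lucas; the error for the approximating polynomial is of order \<open>ln n / n\<close>.
\<close>

theorem critical_average_close_to_root_average:
  fixes f :: "complex \<Rightarrow> complex"
  assumes f: "continuous_on (cball 0 1) f" and e: "e > 0"
  shows "eventually (\<lambda>n. \<forall>z y. critical_enum z n y \<longrightarrow> (\<forall>i\<in>{1..n}. norm (z i) = 1) \<longrightarrow>
           norm (\<Sum>i=1..n. z i) \<ge> 1 \<longrightarrow>
           norm ((\<Sum>j<n-1. f (y j)) / of_nat (n - 1) - (\<Sum>i=1..n. f (z i)) / of_nat n) \<le> e)
         sequentially"
proof -
  obtain g where g: "bipoly g" "\<And>z. z \<in> cball 0 1 \<Longrightarrow> norm (f z - g z) < e / 3"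
    using bipoly_dense[OF f compact_cball, of "e / 3"] e by auto
  obtain K where K: "K \<ge> 0" "averages_comparable g K"
    using averages_comparable_bipoly[OF g(1)] by blast
  have "(\<lambda>n. K * (1 + ln (real n)) / real (n - 1)) \<longlonglongrightarrow> 0"
    by real_asymp
  hence "eventually (\<lambda>n. K * (1 + ln (real n)) / real (n - 1) < e / 3) sequentially"
    using e by (intro order_tendstoD) auto
  moreover have "eventually (\<lambda>n::nat. n \<ge> 2) sequentially"
    by (rule eventually_ge_at_top)
  ultimately show ?thesis
  proof eventually_elim
    case (elim n)
    show ?case
    proof (intro allI impI)
      fix z y
      assume y: "critical_enum z n y" and z: "\<forall>i\<in>{1..n}. norm (z i) = 1"
        and S: "norm (\<Sum>i=1..n. z i) \<ge> 1"
      let ?Y = "\<lambda>f. (\<Sum>j<n-1. f (y j)) / of_nat (n - 1)"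
      let ?Z = "\<lambda>f. (\<Sum>i=1..n. f (z i)) / of_nat n"
      have "norm (?Y g - ?Z g) \<le> K * (1 + (\<Sum>j<n-1. 1 - norm (y j))) / real (n - 1)"
        using K(2) elim y z unfolding averages_comparable_def by blast
      also have "\<dots> \<le> K * (1 + ln (real n)) / real (n - 1)"
        using K(1) sum_deficit_le_ln[OF y _ S] z elim
        by (intro divide_right_mono mult_left_mono) auto
      finally have 1: "norm (?Y g - ?Z g) \<le> e / 3" using elim(1) by (rule order.trans[OF _ less_imp_le])
      have "norm (?Y f - ?Y g) \<le> e / 3"
      proof -
        have "norm (y j) \<le> 1" if "j < n - 1" for j
          using Gauss_Lucas_cball[OF y _ that, of 1] z by simp
        hence "norm (f (y j) - g (y j)) \<le> e / 3" if "j \<in> {..<n-1}" for j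
          using g(2)[of "y j"] that by (simp add: less_imp_le)
        from norm_average_diff_le[of "{..<n-1}" "\<lambda>j. f (y j)" "\<lambda>j. g (y j)", OF this] show ?thesis using e by simp
      qed
      moreover have "norm (?Z f - ?Z g) \<le> e / 3"
      proof -
        have "norm (f (z i) - g (z i)) \<le> e / 3" if "i \<in> {1..n}" for i
          using g(2)[of "z i"] that z by (simp add: less_imp_le)
        from norm_average_diff_le[of "{1..n}" "\<lambda>i. f (z i)" "\<lambda>i. g (z i)", OF this] show ?thesis using e by simp
      qed
      moreover have "norm (?Y f - ?Z f) = norm ((?Y f - ?Y g) + (?Y g - ?Z g) - (?Z f - ?Z g))"
        by (rule arg_cong[of _ _ norm]) simp
      ultimately show "norm (?Y f - ?Z f) \<le> e"
        using 1 norm_triangle_ineq4[of "(?Y f - ?Y g) + (?Y g - ?Z g)" "?Z f - ?Z g"]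
          norm_triangle_ineq[of "?Y f - ?Y g" "?Y g - ?Z g"] by linarith
    qed
  qed
qed

section \<open>Measurability of averages over the critical points\<close>

text \<open>
  A sequence failing to converge has a subsequence that stays away from the limit.
\<close>

lemma LIMSEQ_if_subsequences:
  fixes X :: "nat \<Rightarrow> 'a :: metric_space"
  assumes "\<And>r :: nat \<Rightarrow> nat. strict_mono r \<Longrightarrow> \<exists>s :: nat \<Rightarrow> nat. strict_mono s \<and> (X \<circ> r \<circ> s) \<longlonglongrightarrow> L"
  shows "X \<longlonglongrightarrow> L"
proof (rule ccontr)
  assume "\<not> X \<longlonglongrightarrow> L"
  then obtain e where e: "e > 0" and "\<exists>\<^sub>F k in sequentially. \<not> dist (X k) L < e"
    unfolding tendsto_iff by (auto simp: frequently_def)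
  hence "infinite {k. \<not> dist (X k) L < e}"
    by (simp add: frequently_sequentially infinite_nat_iff_unbounded_le)
  then obtain r :: "nat \<Rightarrow> nat" where r: "strict_mono r" "\<And>k. r k \<in> {k. \<not> dist (X k) L < e}"
    using infinite_enumerate by blast
  obtain s where s: "strict_mono s" "(X \<circ> r \<circ> s) \<longlonglongrightarrow> L"
    using assms[OF r(1)] by blast
  have "eventually (\<lambda>k. dist ((X \<circ> r \<circ> s) k) L < e) sequentially"
    using tendstoD[OF s(2) e] .
  then obtain k where "dist ((X \<circ> r \<circ> s) k) L < e"
    using eventually_happens'[OF sequentially_bot] by blast
  thus False using r(2)[of "s k"] by simp
qed

lemma tendsto_fun_iff:
  fixes x :: "nat \<Rightarrow> 'i::countable \<Rightarrow> 'a :: metric_space"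
  shows "x \<longlonglongrightarrow> a \<longleftrightarrow> (\<forall>i. (\<lambda>k. x k i) \<longlonglongrightarrow> a i)"
proof
  assume x: "x \<longlonglongrightarrow> a"
  show "\<forall>i. (\<lambda>k. x k i) \<longlonglongrightarrow> a i"
  proof
    fix i
    have "continuous_on UNIV (\<lambda>f :: 'i \<Rightarrow> 'a. f i)"
      by (rule continuous_on_product_coordinates)
    hence "isCont (\<lambda>f :: 'i \<Rightarrow> 'a. f i) a"
      using continuous_on_eq_continuous_at[OF open_UNIV] by blast
    thus "(\<lambda>k. x k i) \<longlonglongrightarrow> a i" using x by (rule isCont_tendsto_compose)
  qed
next
  assume "\<forall>i. (\<lambda>k. x k i) \<longlonglongrightarrow> a i"
  thus "x \<longlonglongrightarrow> a"
    using limitin_componentwise[of "\<lambda>_::'i. euclidean :: 'a topology" UNIV x a sequentially]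
    by (simp add: euclidean_product_topology)
qed

lemma compact_cball_functions:
  "compact (PiE UNIV (\<lambda>_::nat. cball (0::complex) R))"
  using compactin_PiE[of "\<lambda>_::nat. euclidean :: complex topology" UNIV "\<lambda>_. cball 0 R"]
  by (simp add: euclidean_product_topology)

lemma critical_enum_cong:
  assumes "critical_enum z n y" "\<And>j. j < n - 1 \<Longrightarrow> y' j = y j"
  shows "critical_enum z n y'"
  using assms by (simp add: critical_enum_def)

text \<open>
  Roots depend continuously on the polynomial as an unordered family only, and no continuous
  numbering of the critical points exists in general. Compactness replaces it: for a convergent
  sequence of root families, the numberings of the critical points lie in a compact set, and the
  limit of any convergent subsequence numbers the critical points of the limit polynomial. The sum
  of \<open>f\<close> does not depend on the numbering, so all these subsequential limits agree.
\<close>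

lemma continuous_integral_root_measure:
  fixes f :: "complex \<Rightarrow> complex"
  assumes f: "continuous_on UNIV f" and n: "n \<ge> 2"
  shows "continuous_on UNIV (\<lambda>z. \<integral>x. f x \<partial>root_measure (pderiv (root_poly z n)))"
  unfolding continuous_on_sequentially
proof (intro allI impI ballI)
  let ?F = "\<lambda>z. \<integral>x. f x \<partial>root_measure (pderiv (root_poly z n))"
  fix z :: "nat \<Rightarrow> nat \<Rightarrow> complex" and a
  assume "(\<forall>k. z k \<in> UNIV) \<and> z \<longlonglongrightarrow> a"
  hence z: "(\<lambda>k. z k i) \<longlonglongrightarrow> a i" for i
    by (simp add: tendsto_fun_iff)
  have fm: "f \<in> borel_measurable borel"
    using f by (rule borel_measurable_continuous_onI)
  have F: "?F w = (\<Sum>j<n-1. f (y j)) / of_nat (n - 1)" if "critical_enum w n y" for w y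
    using that n fm by (rule integral_critical_enum)
  have "\<exists>B. \<forall>k. norm (z k i) \<le> B" for i
    using convergent_imp_Bseq[OF convergentI[OF z[of i]]] by (auto simp: Bseq_def)
  then obtain B where B: "\<And>i k. norm (z k i) \<le> B i" by metis
  define R where "R = (\<Sum>i=1..n. B i)"
  have B0: "B i \<ge> 0" for i by (rule order.trans[OF norm_ge_zero B])
  have R: "norm (z k i) \<le> R" if "i \<in> {1..n}" for i k
  proof -
    have "B i \<le> R" unfolding R_def using that B0 by (intro member_le_sum) auto
    thus ?thesis using B[of k i] by linarith
  qed
  have "R \<ge> 0" unfolding R_def using B0 by (intro sum_nonneg) auto
  \<comment> \<open>Outside \<open>j < n - 1\<close> the numbering is set to \<open>0\<close>, so that it lies in a compact product.\<close>
  have "\<exists>y. critical_enum (z k) n y \<and> y \<in> PiE UNIV (\<lambda>_. cball 0 R)" for k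
  proof -
    have "n \<ge> 1" using n by simp
    then obtain y where y: "critical_enum (z k) n y"
      by (rule critical_enum_exists)
    define y' where "y' j = (if j < n - 1 then y j else 0)" for j
    have "norm (y' j) \<le> R" for j
      using Gauss_Lucas_cball[OF y R, of j] \<open>R \<ge> 0\<close> by (auto simp: y'_def)
    moreover have "critical_enum (z k) n y'"
      using y by (rule critical_enum_cong) (simp add: y'_def)
    ultimately show ?thesis by (intro exI[of _ y']) (auto simp: PiE_def)
  qed
  then obtain y where y: "\<And>k. critical_enum (z k) n (y k)"
    and yR: "\<And>k. y k \<in> PiE UNIV (\<lambda>_. cball 0 R)" by metis
  show "(?F \<circ> z) \<longlonglongrightarrow> ?F a"
  proof (rule LIMSEQ_if_subsequences)
    fix r :: "nat \<Rightarrow> nat" assume r: "strict_mono r"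
    have "seq_compact (PiE UNIV (\<lambda>_::nat. cball (0::complex) R))"
      using compact_cball_functions by (rule compact_imp_seq_compact)
    then obtain l s where s: "strict_mono s" and "((y \<circ> r) \<circ> s) \<longlonglongrightarrow> l"
      using yR unfolding seq_compact_def by (metis (no_types, lifting) comp_apply)
    hence yl: "(\<lambda>k. y (r (s k)) j) \<longlonglongrightarrow> l j" for j
      by (simp add: tendsto_fun_iff o_def)
    have zl: "(\<lambda>k. z (r (s k)) i) \<longlonglongrightarrow> a i" for i
      using LIMSEQ_subseq_LIMSEQ[OF z[of i] strict_mono_o[OF r s]] by (simp add: o_def)
    have "critical_enum a n l"
    proof (rule critical_enumI)
      fix x
      have "(\<lambda>k. of_nat n * (\<Prod>j<n-1. x - y (r (s k)) j)) \<longlonglongrightarrow> of_nat n * (\<Prod>j<n-1. x - l j)"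
        by (intro tendsto_intros yl)
      moreover have "(\<lambda>k. \<Sum>i=1..n. \<Prod>l\<in>{1..n}-{i}. x - z (r (s k)) l)
          \<longlonglongrightarrow> (\<Sum>i=1..n. \<Prod>l\<in>{1..n}-{i}. x - a l)"
        by (intro tendsto_intros zl)
      moreover have "(\<lambda>k. of_nat n * (\<Prod>j<n-1. x - y (r (s k)) j))
          = (\<lambda>k. \<Sum>i=1..n. \<Prod>l\<in>{1..n}-{i}. x - z (r (s k)) l)"
        using critical_enum_poly[OF y] by blast
      ultimately show "of_nat n * (\<Prod>j<n-1. x - l j) = (\<Sum>i=1..n. \<Prod>l\<in>{1..n}-{i}. x - a l)"
        using LIMSEQ_unique by metis
    qed
    hence "?F a = (\<Sum>j<n-1. f (l j)) / of_nat (n - 1)" by (rule F)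
    moreover have "(\<lambda>k. (\<Sum>j<n-1. f (y (r (s k)) j)) / of_nat (n - 1))
        \<longlonglongrightarrow> (\<Sum>j<n-1. f (l j)) / of_nat (n - 1)"
    proof -
      have "(\<lambda>k. f (y (r (s k)) j)) \<longlonglongrightarrow> f (l j)" for j
        using f yl[of j] by (auto simp: continuous_on_eq_continuous_at intro: isCont_tendsto_compose)
      thus ?thesis using n by (intro tendsto_intros) auto
    qed
    ultimately have "(?F \<circ> z \<circ> r \<circ> s) \<longlonglongrightarrow> ?F a"
      by (simp add: o_def F[OF y])
    thus "\<exists>s. strict_mono s \<and> (?F \<circ> z \<circ> r \<circ> s) \<longlonglongrightarrow> ?F a" using s by blast
  qed
qed

text \<open>
  Continuity on the product space yields measurability. For \<open>n \<le> 1\<close> the derivative does not depend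
  on the roots.
\<close>

lemma measurable_integral_root_measure:
  fixes f :: "complex \<Rightarrow> complex"
  assumes f: "continuous_on UNIV f" and Z: "\<And>i. i \<ge> 1 \<Longrightarrow> Z i \<in> borel_measurable M"
  shows "(\<lambda>\<omega>. \<integral>x. f x \<partial>root_measure (pderiv (root_poly (\<lambda>i. Z i \<omega>) n))) \<in> borel_measurable M"
proof (cases "n \<ge> 2")
  case True
  \<comment> \<open>Replacing the value at index \<open>0\<close> makes every coordinate of \<open>W\<close> measurable.\<close>
  define W where "W \<omega> i = (if i \<ge> 1 then Z i \<omega> else 0)" for \<omega> and i :: nat
  have "(\<lambda>\<omega>. W \<omega> i) \<in> borel_measurable M" for i
    using Z[of i] by (cases "i \<ge> 1") (simp_all add: W_def)
  hence "W \<in> borel_measurable M" by (rule measurable_coordinatewise_then_product)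
  moreover have "root_poly (\<lambda>i. Z i \<omega>) n = root_poly (W \<omega>) n" for \<omega>
    by (simp add: root_poly_def W_def)
  ultimately show ?thesis
    using measurable_compose[OF _ borel_measurable_continuous_onI[OF
        continuous_integral_root_measure[OF f True]]] by simp
next
  case False
  hence "n = 0 \<or> n = 1" by auto
  hence "pderiv (root_poly z n) = (if n = 0 then 0 else 1)" for z
    by (auto simp: root_poly_def pderiv_pCons)
  thus ?thesis by simp
qed

section \<open>Laws of large numbers and escape from the unit disc\<close>

lemma measure_std_normal_le:
  assumes "\<delta> \<ge> 0"
  shows "measure std_normal_distribution {-\<delta><..\<delta>} \<le> 2 * \<delta>"
proof -
  have "std_normal_density x \<le> 1" for x
  proof -
    have "1 / sqrt (2 * pi) \<le> 1" using pi_ge_two by (simp add: real_le_rsqrt)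
    moreover have "exp (- x\<^sup>2 / 2) \<le> 1" by simp
    ultimately have "1 / sqrt (2 * pi) * exp (- x\<^sup>2 / 2) \<le> 1 * 1"
      by (intro mult_mono) auto
    thus ?thesis by (simp add: std_normal_density_def)
  qed
  hence "emeasure std_normal_distribution {-\<delta><..\<delta>} \<le> (\<integral>\<^sup>+x. indicator {-\<delta><..\<delta>} x \<partial>lborel)"
    by (auto simp: emeasure_density indicator_def intro!: nn_integral_mono)
  also have "\<dots> = ennreal (2 * \<delta>)"
    using assms by simp
  finally show ?thesis
    using assms by (simp add: measure_def enn2real_leI)
qed

lemma isCont_cdf_std_normal: "isCont (cdf std_normal_distribution) x"
proof -
  interpret real_distribution std_normal_distribution by (rule real_dist_normal_dist)
  have "emeasure std_normal_distribution {x} = 0"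
    by (auto simp: emeasure_density nn_integral_0_iff_AE intro!: AE_I[of _ _ "{x}"])
  thus ?thesis by (simp add: isCont_cdf measure_def)
qed

text \<open>
  By the central limit theorem the sum has size of order \<open>sqrt n\<close>, and the limit law gives an
  interval of radius \<open>\<delta>\<close> mass at most \<open>2 \<delta>\<close>. A fixed interval therefore has vanishing mass.
\<close>

lemma (in prob_space) small_ball_prob_tendsto_0:
  fixes X :: "nat \<Rightarrow> 'a \<Rightarrow> real" and \<nu> :: "real measure"
  assumes indep: "indep_vars (\<lambda>_. borel) X UNIV"
    and distr: "\<And>i. distr M borel (X i) = \<nu>"
    and bounded: "\<And>i. AE \<omega> in M. \<bar>X i \<omega>\<bar> \<le> B"
    and mean: "\<And>i. expectation (X i) = 0"
    and var: "\<And>i. expectation (\<lambda>\<omega>. (X i \<omega>)\<^sup>2) = v" and v: "v > 0"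
  shows "(\<lambda>n. prob {\<omega>\<in>space M. \<bar>\<Sum>i<n. X i \<omega>\<bar> < 1}) \<longlonglongrightarrow> 0"
proof -
  have [measurable]: "random_variable borel (X i)" for i
    using indep unfolding indep_vars_def2 by simp
  define T where "T n \<omega> = (\<Sum>i<n. X i \<omega>) / sqrt (n * (sqrt v)\<^sup>2)" for n \<omega>
  have [measurable]: "random_variable borel (T n)" for n
    unfolding T_def by measurable
  have sq: "integrable M (\<lambda>\<omega>. (X i \<omega>)\<^sup>2)" for i
  proof (rule integrable_const_bound[where B = "B\<^sup>2"])
    show "AE \<omega> in M. norm ((X i \<omega>)\<^sup>2) \<le> B\<^sup>2"
      using bounded[of i] by eventually_elim (simp add: abs_le_square_iff[symmetric])
  qed measurable
  have clt: "weak_conv_m (\<lambda>n. distr M borel (T n)) std_normal_distribution"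
    unfolding T_def
    by (rule central_limit_theorem_zero_mean[OF indep mean _ sq _ distr])
       (use v in \<open>simp_all add: mean var\<close>)
  have "eventually (\<lambda>n. prob {\<omega>\<in>space M. \<bar>\<Sum>i<n. X i \<omega>\<bar> < 1} < e) sequentially"
    if e: "e > 0" for e
  proof -
    \<comment> \<open>the limit law then gives \<open>{-\<delta><..\<delta>}\<close> mass at most \<open>e / 2\<close>\<close>
    define \<delta> where "\<delta> = e / 4"
    have \<delta>: "\<delta> > 0" using e by (simp add: \<delta>_def)
    interpret N: real_distribution std_normal_distribution by (rule real_dist_normal_dist)
    let ?c = "\<lambda>n. cdf (distr M borel (T n))" and ?\<Phi> = "cdf std_normal_distribution"
    have "(\<lambda>n. ?c n \<delta> - ?c n (-\<delta>)) \<longlonglongrightarrow> ?\<Phi> \<delta> - ?\<Phi> (-\<delta>)"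
      using clt isCont_cdf_std_normal unfolding weak_conv_m_def weak_conv_def
      by (intro tendsto_diff) blast+
    moreover have "?\<Phi> \<delta> - ?\<Phi> (-\<delta>) < e"
      using measure_std_normal_le[of \<delta>] e \<delta> by (simp add: N.cdf_diff_eq \<delta>_def)
    ultimately have "eventually (\<lambda>n. ?c n \<delta> - ?c n (-\<delta>) < e) sequentially"
      by (rule order_tendstoD)
    moreover have "eventually (\<lambda>n. sqrt (real n * v) > 1 / \<delta>) sequentially"
      using v by real_asymp
    ultimately show ?thesis
    proof eventually_elim
      case (elim n)
      interpret D: real_distribution "distr M borel (T n)"
        by (rule real_distribution_distr) simp
      have "0 < 1 / \<delta>" using \<delta> by simp
      hence s0: "sqrt (real n * v) > 0" using elim(2) by (rule less_trans)
      have s1: "1 < \<delta> * sqrt (real n * v)"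
        using elim(2) \<delta> by (simp add: field_simps)
      have "prob {\<omega>\<in>space M. \<bar>\<Sum>i<n. X i \<omega>\<bar> < 1} \<le> prob (T n -` {-\<delta><..\<delta>} \<inter> space M)"
      proof (rule finite_measure_mono)
        show "{\<omega>\<in>space M. \<bar>\<Sum>i<n. X i \<omega>\<bar> < 1} \<subseteq> T n -` {-\<delta><..\<delta>} \<inter> space M"
        proof (rule subsetI)
          fix \<omega> assume \<omega>: "\<omega> \<in> {\<omega>\<in>space M. \<bar>\<Sum>i<n. X i \<omega>\<bar> < 1}"
          hence "\<bar>\<Sum>i<n. X i \<omega>\<bar> < \<delta> * sqrt (real n * v)" using s1 by simp
          hence "\<bar>T n \<omega>\<bar> < \<delta>"
            using s0 v by (simp add: T_def abs_divide pos_divide_less_eq)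
          thus "\<omega> \<in> T n -` {-\<delta><..\<delta>} \<inter> space M" using \<omega> by auto
        qed
        show "T n -` {-\<delta><..\<delta>} \<inter> space M \<in> events"
          by (rule measurable_sets[where A = borel]) auto
      qed
      also have "\<dots> = ?c n \<delta> - ?c n (-\<delta>)"
        using \<delta> by (subst D.cdf_diff_eq) (auto simp: measure_distr)
      finally show ?case using elim(1) by simp
    qed
  qed
  moreover have "eventually (\<lambda>n. a < prob {\<omega>\<in>space M. \<bar>\<Sum>i<n. X i \<omega>\<bar> < 1}) sequentially"
    if "a < 0" for a
    by (intro always_eventually allI less_le_trans[OF that measure_nonneg])
  ultimately show ?thesis by (intro order_tendstoI)
qed

locale iid_complex = prob_space M for M :: "'w measure" +
  fixes Z :: "nat \<Rightarrow> 'w \<Rightarrow> complex" and \<mu> :: "complex measure"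
  assumes indep: "indep_vars (\<lambda>_. borel) Z {1..}"
    and distr_Z: "\<And>i. i \<ge> 1 \<Longrightarrow> distr M borel (Z i) = \<mu>"
begin

lemma measurable_Z [measurable]: "i \<ge> 1 \<Longrightarrow> Z i \<in> borel_measurable M"
  using indep unfolding indep_vars_def2 by auto

lemma sets_mu [simp, measurable_cong]: "sets \<mu> = sets borel"
  using distr_Z[of 1] by (metis order_refl sets_distr)

lemma prob_space_mu: "prob_space \<mu>"
  using distr_Z[of 1] prob_space_distr[OF measurable_Z[of 1]] by simp

lemma AE_Z:
  assumes "AE x in \<mu>. P x" "i \<ge> 1"
  shows "AE \<omega> in M. P (Z i \<omega>)"
proof (rule AE_distrD[OF measurable_Z[OF assms(2)]])
  show "AE x in distr M borel (Z i). P x" unfolding distr_Z[OF assms(2)] by (rule assms(1))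
qed

lemma expectation_Z:
  fixes f :: "complex \<Rightarrow> 'b::{banach, second_countable_topology}"
  assumes "i \<ge> 1" "f \<in> borel_measurable borel"
  shows "expectation (\<lambda>\<omega>. f (Z i \<omega>)) = (\<integral>x. f x \<partial>\<mu>)"
  using assms distr_Z[of i] integral_distr[OF measurable_Z[of i], of f] by simp

lemma distr_comp_Z:
  assumes "i \<ge> 1" "f \<in> borel_measurable borel"
  shows "distr M borel (\<lambda>\<omega>. f (Z i \<omega>)) = distr \<mu> borel f"
  using assms distr_Z[of i] distr_distr[OF _ measurable_Z[of i], of f borel] by (simp add: o_def)

text \<open>
  Hoeffding's inequality, which even gives an exponential rate.
\<close>

lemma weak_law_real:
  fixes f :: "complex \<Rightarrow> real"
  assumes f [measurable]: "f \<in> borel_measurable borel" and B: "AE x in \<mu>. \<bar>f x\<bar> \<le> B" and e: "e > 0"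
  shows "(\<lambda>n. prob {\<omega>\<in>space M. \<bar>(\<Sum>i=1..n. f (Z i \<omega>)) / n - (\<integral>x. f x \<partial>\<mu>)\<bar> \<ge> e}) \<longlonglongrightarrow> 0"
proof (rule tendsto_sandwich[OF _ _ tendsto_const])
  \<comment> \<open>enlarged so that the interval \<open>{-C..C}\<close> is never degenerate\<close>
  define C where "C = \<bar>B\<bar> + 1"
  have C: "C > 0" by (simp add: C_def)
  show "eventually (\<lambda>n. prob {\<omega>\<in>space M. \<bar>(\<Sum>i=1..n. f (Z i \<omega>)) / n - (\<integral>x. f x \<partial>\<mu>)\<bar> \<ge> e}
          \<le> 2 * exp (-2 * real n * e\<^sup>2 / (C - (-C))\<^sup>2)) sequentially"
    using eventually_ge_at_top[of 1]
  proof eventually_elim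
    case (elim n)
    interpret H: Hoeffding_ineq_iid M "{1..n}" "\<lambda>i \<omega>. f (Z i \<omega>)" "\<lambda>\<omega>. f (Z 1 \<omega>)" "-C" C
      "expectation (\<lambda>\<omega>. f (Z 1 \<omega>))"
    proof unfold_locales
      show "indep_vars (\<lambda>_. borel) (\<lambda>i \<omega>. f (Z i \<omega>)) {1..n}"
        by (rule indep_vars_compose2[where M' = "\<lambda>_. borel"])
           (auto intro: indep_vars_subset[OF indep])
      show "AE x in M. f (Z 1 x) \<in> {-C..C}"
        using AE_Z[OF B, of 1] by (auto simp: C_def)
      show "distr M borel (\<lambda>\<omega>. f (Z i \<omega>)) = distr M borel (\<lambda>\<omega>. f (Z 1 \<omega>))" if "i \<in> {1..n}" for i
        using that by (simp add: distr_comp_Z[OF _ f])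
      show "random_variable borel (\<lambda>\<omega>. f (Z 1 \<omega>))" by measurable
    qed simp_all
    show ?case
    proof -
      have E: "expectation (\<lambda>\<omega>. f (Z 1 \<omega>)) = (\<integral>x. f x \<partial>\<mu>)"
        by (rule expectation_Z[OF _ f]) simp
      have "{1..n} \<noteq> {}" using elim by simp
      moreover have "-C < C" using C by simp
      ultimately show ?thesis
        using H.Hoeffding_ineq_abs_ge'[of e] e unfolding E card_atLeastAtMost by simp
    qed
  qed
  have "(\<lambda>n. 2 * exp (-2 * real n * c)) \<longlonglongrightarrow> 0" if "c > 0" for c
    using that by real_asymp
  from this[of "e\<^sup>2 / (C - (-C))\<^sup>2"]
  have "(\<lambda>n. 2 * exp (-2 * real n * (e\<^sup>2 / (C - (-C))\<^sup>2))) \<longlonglongrightarrow> 0"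
    using C e by simp
  thus "(\<lambda>n. 2 * exp (-2 * real n * e\<^sup>2 / (C - (-C))\<^sup>2)) \<longlonglongrightarrow> 0"
    by simp
qed auto

lemma weak_law:
  fixes f :: "complex \<Rightarrow> complex"
  assumes f [measurable]: "f \<in> borel_measurable borel" and B: "AE x in \<mu>. norm (f x) \<le> B" and e: "e > 0"
  shows "(\<lambda>n. prob {\<omega>\<in>space M. norm ((\<Sum>i=1..n. f (Z i \<omega>)) / of_nat n - (\<integral>x. f x \<partial>\<mu>)) \<ge> e}) \<longlonglongrightarrow> 0"
proof -
  interpret mu: prob_space \<mu> by (rule prob_space_mu)
  have int: "integrable \<mu> f"
    by (rule mu.integrable_const_bound[OF B]) simp
  let ?R = "\<lambda>n. {\<omega>\<in>space M. \<bar>(\<Sum>i=1..n. Re (f (Z i \<omega>))) / n - (\<integral>x. Re (f x) \<partial>\<mu>)\<bar> \<ge> e / 2}"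
  let ?I = "\<lambda>n. {\<omega>\<in>space M. \<bar>(\<Sum>i=1..n. Im (f (Z i \<omega>))) / n - (\<integral>x. Im (f x) \<partial>\<mu>)\<bar> \<ge> e / 2}"
  have [measurable]: "?R n \<in> events" "?I n \<in> events" for n by measurable
  show ?thesis
  proof (rule tendsto_sandwich[OF _ _ tendsto_const])
    have "AE x in \<mu>. \<bar>Re (f x)\<bar> \<le> B" "AE x in \<mu>. \<bar>Im (f x)\<bar> \<le> B"
      using B by (auto elim!: eventually_mono intro: abs_Re_le_cmod[THEN order.trans] abs_Im_le_cmod[THEN order.trans])
    hence "(\<lambda>n. prob (?R n) + prob (?I n)) \<longlonglongrightarrow> 0 + 0"
      using e by (intro tendsto_add weak_law_real[where B = B]) auto
    thus "(\<lambda>n. prob (?R n) + prob (?I n)) \<longlonglongrightarrow> 0" by simp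
    show "eventually (\<lambda>n. prob {\<omega>\<in>space M. norm ((\<Sum>i=1..n. f (Z i \<omega>)) / of_nat n - (\<integral>x. f x \<partial>\<mu>)) \<ge> e}
        \<le> prob (?R n) + prob (?I n)) sequentially"
    proof (intro always_eventually allI)
      fix n
      have "prob {\<omega>\<in>space M. norm ((\<Sum>i=1..n. f (Z i \<omega>)) / of_nat n - (\<integral>x. f x \<partial>\<mu>)) \<ge> e}
          \<le> prob (?R n \<union> ?I n)"
      proof (rule finite_measure_mono)
        show "{\<omega>\<in>space M. norm ((\<Sum>i=1..n. f (Z i \<omega>)) / of_nat n - (\<integral>x. f x \<partial>\<mu>)) \<ge> e} \<subseteq> ?R n \<union> ?I n"
        proof safe
          fix \<omega>
          let ?w = "(\<Sum>i=1..n. f (Z i \<omega>)) / of_nat n - (\<integral>x. f x \<partial>\<mu>)"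
          assume *: "e \<le> norm ?w"
            and "\<not> e / 2 \<le> \<bar>(\<Sum>i=1..n. Im (f (Z i \<omega>))) / n - (\<integral>x. Im (f x) \<partial>\<mu>)\<bar>"
          moreover have "Re ?w = (\<Sum>i=1..n. Re (f (Z i \<omega>))) / n - (\<integral>x. Re (f x) \<partial>\<mu>)"
            "Im ?w = (\<Sum>i=1..n. Im (f (Z i \<omega>))) / n - (\<integral>x. Im (f x) \<partial>\<mu>)"
            using int by simp_all
          ultimately show "e / 2 \<le> \<bar>(\<Sum>i=1..n. Re (f (Z i \<omega>))) / n - (\<integral>x. Re (f x) \<partial>\<mu>)\<bar>"
            using cmod_le[of ?w] by linarith
        qed
      qed simp
      also have "\<dots> \<le> prob (?R n) + prob (?I n)"
        by (rule measure_Un_le) auto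
      finally show "prob {\<omega>\<in>space M. norm ((\<Sum>i=1..n. f (Z i \<omega>)) / of_nat n - (\<integral>x. f x \<partial>\<mu>)) \<ge> e}
        \<le> prob (?R n) + prob (?I n)" .
    qed
  qed auto
qed

text \<open>
  The roots are numbered from \<open>1\<close>, the variables in the central limit theorem from \<open>0\<close>.
\<close>

lemma coordinate_small_ball:
  fixes f :: "complex \<Rightarrow> real"
  assumes f [measurable]: "f \<in> borel_measurable borel" and B: "AE x in \<mu>. \<bar>f x\<bar> \<le> B"
    and mean: "(\<integral>x. f x \<partial>\<mu>) = 0" and var: "(\<integral>x. (f x)\<^sup>2 \<partial>\<mu>) > 0"
  shows "(\<lambda>n. prob {\<omega>\<in>space M. \<bar>\<Sum>i=1..n. f (Z i \<omega>)\<bar> < 1}) \<longlonglongrightarrow> 0"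
proof -
  \<comment> \<open>Grouping into the singletons \<open>{Suc i}\<close> reindexes the independent family.\<close>
  have "indep_vars (\<lambda>i. PiM {Suc i} (\<lambda>_. borel)) (\<lambda>i \<omega>. restrict (\<lambda>j. Z j \<omega>) {Suc i}) UNIV"
    by (rule indep_vars_restrict[OF indep]) (auto simp: disjoint_family_on_def)
  hence "indep_vars (\<lambda>_. borel) (\<lambda>i \<omega>. f (restrict (\<lambda>j. Z j \<omega>) {Suc i} (Suc i))) UNIV"
    by (rule indep_vars_compose2[where Y = "\<lambda>i w. f (w (Suc i))"]) measurable
  hence ind: "indep_vars (\<lambda>_. borel) (\<lambda>i \<omega>. f (Z (Suc i) \<omega>)) UNIV"
    by simp
  have f2: "(\<lambda>x. (f x)\<^sup>2) \<in> borel_measurable borel" by measurable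
  have "(\<lambda>n. prob {\<omega>\<in>space M. \<bar>\<Sum>i<n. f (Z (Suc i) \<omega>)\<bar> < 1}) \<longlonglongrightarrow> 0"
  proof (rule small_ball_prob_tendsto_0[OF ind])
    show "distr M borel (\<lambda>\<omega>. f (Z (Suc i) \<omega>)) = distr \<mu> borel f" for i
      by (rule distr_comp_Z[OF _ f]) simp
    show "AE \<omega> in M. \<bar>f (Z (Suc i) \<omega>)\<bar> \<le> B" for i
      by (rule AE_Z[OF B]) simp
    show "expectation (\<lambda>\<omega>. f (Z (Suc i) \<omega>)) = 0" for i
      using expectation_Z[OF _ f, of "Suc i"] mean by simp
    show "expectation (\<lambda>\<omega>. (f (Z (Suc i) \<omega>))\<^sup>2) = (\<integral>x. (f x)\<^sup>2 \<partial>\<mu>)" for i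
      using expectation_Z[OF _ f2, of "Suc i"] by simp
  qed (rule var)
  moreover have "(\<Sum>i<n. f (Z (Suc i) \<omega>)) = (\<Sum>i=1..n. f (Z i \<omega>))" for n \<omega>
    by (rule sum.reindex_bij_witness[of _ "\<lambda>i. i - 1" Suc]) auto
  ultimately show ?thesis by simp
qed

lemma prob_mono_tendsto_0:
  assumes "eventually (\<lambda>n. A n \<subseteq> B n) sequentially" "\<And>n. B n \<in> events"
    and "(\<lambda>n. prob (B n)) \<longlonglongrightarrow> 0"
  shows "(\<lambda>n. prob (A n)) \<longlonglongrightarrow> 0"
proof (rule tendsto_sandwich[OF _ _ tendsto_const assms(3)])
  show "eventually (\<lambda>n. prob (A n) \<le> prob (B n)) sequentially"
    using assms(1) by eventually_elim (rule finite_measure_mono[OF _ assms(2)])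
qed simp

text \<open>
  If the mean of \<open>\<mu>\<close> is not zero, the sum grows linearly by the law of large numbers. If it is
  zero, then \<open>Re\<close> or \<open>Im\<close> has positive variance, because the two second moments add up to \<open>1\<close> on
  the circle, and that coordinate alone already escapes.
\<close>

lemma prob_small_sum_tendsto_0:
  assumes circle: "AE z in \<mu>. z \<in> sphere 0 1"
  shows "(\<lambda>n. prob {\<omega>\<in>space M. norm (\<Sum>i=1..n. Z i \<omega>) < 1}) \<longlonglongrightarrow> 0"
proof -
  interpret mu: prob_space \<mu> by (rule prob_space_mu)
  define m where "m = (\<integral>z. z \<partial>\<mu>)"
  have n1: "AE z in \<mu>. norm z \<le> 1" using circle by eventually_elim auto
  have int: "integrable \<mu> (\<lambda>z. z)"
    by (rule mu.integrable_const_bound[OF n1]) simp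
  show ?thesis
  proof (cases "m = 0")
    case False
    let ?B = "\<lambda>n. {\<omega>\<in>space M. norm ((\<Sum>i=1..n. Z i \<omega>) / of_nat n - m) \<ge> norm m / 2}"
    show ?thesis
    proof (rule prob_mono_tendsto_0)
      show "(\<lambda>n. prob (?B n)) \<longlonglongrightarrow> 0"
        unfolding m_def using False n1 by (intro weak_law) (auto simp: m_def)
      show "?B n \<in> events" for n by measurable
      have "eventually (\<lambda>n. 1 / real n < norm m / 2) sequentially"
        using False by (intro order_tendstoD[OF lim_1_over_n]) auto
      moreover have "eventually (\<lambda>n::nat. n > 0) sequentially" by (rule eventually_gt_at_top)
      ultimately show "eventually (\<lambda>n. {\<omega>\<in>space M. norm (\<Sum>i=1..n. Z i \<omega>) < 1} \<subseteq> ?B n) sequentially"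
      proof eventually_elim
        case (elim n)
        show ?case
        proof safe
          fix \<omega> assume "norm (\<Sum>i=1..n. Z i \<omega>) < 1"
          hence "norm ((\<Sum>i=1..n. Z i \<omega>) / of_nat n) < 1 / real n"
            using elim by (simp add: norm_divide divide_strict_right_mono)
          thus "norm m / 2 \<le> norm ((\<Sum>i=1..n. Z i \<omega>) / of_nat n - m)"
            using elim norm_triangle_ineq2[of m "(\<Sum>i=1..n. Z i \<omega>) / of_nat n"]
            by (simp add: norm_minus_commute)
        qed
      qed
    qed
  next
    case True
    have bd: "AE z in \<mu>. \<bar>Re z\<bar> \<le> 1" "AE z in \<mu>. \<bar>Im z\<bar> \<le> 1"
      using n1 by (auto elim!: eventually_mono intro: abs_Re_le_cmod[THEN order.trans] abs_Im_le_cmod[THEN order.trans])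
    have sq: "integrable \<mu> (\<lambda>z. (Re z)\<^sup>2)" "integrable \<mu> (\<lambda>z. (Im z)\<^sup>2)"
      using bd[THEN eventually_mono, of "\<lambda>z. norm ((Re z)\<^sup>2) \<le> 1"]
        bd[THEN eventually_mono, of "\<lambda>z. norm ((Im z)\<^sup>2) \<le> 1"]
      by (auto intro!: mu.integrable_const_bound[where B = 1] simp: abs_square_le_1)
    have means: "(\<integral>z. Re z \<partial>\<mu>) = 0" "(\<integral>z. Im z \<partial>\<mu>) = 0"
      using True int by (simp_all add: m_def)
    have "(\<integral>z. (Re z)\<^sup>2 \<partial>\<mu>) + (\<integral>z. (Im z)\<^sup>2 \<partial>\<mu>) = (\<integral>z. (Re z)\<^sup>2 + (Im z)\<^sup>2 \<partial>\<mu>)"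
      using sq by simp
    also have "\<dots> = (\<integral>z. 1 \<partial>\<mu>)"
      using circle by (intro integral_cong_AE) (auto elim!: eventually_mono simp flip: cmod_power2)
    finally have "(\<integral>z. (Re z)\<^sup>2 \<partial>\<mu>) + (\<integral>z. (Im z)\<^sup>2 \<partial>\<mu>) = 1"
      by (simp add: mu.prob_space)
    moreover have "(\<integral>z. (Re z)\<^sup>2 \<partial>\<mu>) \<ge> 0" "(\<integral>z. (Im z)\<^sup>2 \<partial>\<mu>) \<ge> 0" by simp_all
    ultimately consider "(\<integral>z. (Re z)\<^sup>2 \<partial>\<mu>) > 0" | "(\<integral>z. (Im z)\<^sup>2 \<partial>\<mu>) > 0" by linarith
    thus ?thesis
    proof cases
      case 1
      show ?thesis
      proof (rule prob_mono_tendsto_0)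
        show "(\<lambda>n. prob {\<omega>\<in>space M. \<bar>\<Sum>i=1..n. Re (Z i \<omega>)\<bar> < 1}) \<longlonglongrightarrow> 0"
          using bd means 1 by (intro coordinate_small_ball) auto
        show "{\<omega>\<in>space M. \<bar>\<Sum>i=1..n. Re (Z i \<omega>)\<bar> < 1} \<in> events" for n by measurable
      qed (auto intro!: always_eventually intro: order.strict_trans1[OF abs_Re_le_cmod] simp flip: Re_sum)
    next
      case 2
      show ?thesis
      proof (rule prob_mono_tendsto_0)
        show "(\<lambda>n. prob {\<omega>\<in>space M. \<bar>\<Sum>i=1..n. Im (Z i \<omega>)\<bar> < 1}) \<longlonglongrightarrow> 0"
          using bd means 2 by (intro coordinate_small_ball) auto
        show "{\<omega>\<in>space M. \<bar>\<Sum>i=1..n. Im (Z i \<omega>)\<bar> < 1} \<in> events" for n by measurable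
      qed (auto intro!: always_eventually intro: order.strict_trans1[OF abs_Im_le_cmod] simp flip: Im_sum)
    qed
  qed
qed

end

section \<open>Convergence of the empirical measure of the critical points\<close>

text \<open>
  Three exceptional events suffice: some root is off the circle (a null event), the sum of the
  roots is smaller than \<open>1\<close>, or the average of \<open>f\<close> over the roots is far from its mean. Outside
  them the deterministic comparison applies.
\<close>

theorem theorem2p3:
  fixes M :: "'w measure" and Z :: "nat \<Rightarrow> 'w \<Rightarrow> complex" and \<mu> :: "complex measure"
  assumes "sets \<mu> = sets borel" and "prob_space \<mu>" and "AE z in \<mu>. z \<in> sphere 0 1"
    and "prob_space M"
    and "prob_space.indep_vars M (\<lambda>_. borel) Z {1..}"
    and "\<And>i. i \<ge> 1 \<Longrightarrow> distr M borel (Z i) = \<mu>"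
  shows "weakly_tendsto_in_prob M
           (\<lambda>n \<omega>. root_measure (pderiv (root_poly (\<lambda>i. Z i \<omega>) n))) \<mu>"
  unfolding weakly_tendsto_in_prob_def tendsto_in_prob_def
proof (intro allI impI conjI)
  interpret iid_complex M Z \<mu>
    using assms(4-6) by (auto simp: iid_complex_def iid_complex_axioms_def)
  fix f :: "complex \<Rightarrow> complex"
  assume f: "continuous_on UNIV f" and "bounded (range f)"
  then obtain B where B: "\<And>x. norm (f x) \<le> B" by (auto simp: bounded_iff)
  have fm [measurable]: "f \<in> borel_measurable borel"
    using f by (rule borel_measurable_continuous_onI)
  let ?F = "\<lambda>n \<omega>. \<integral>x. f x \<partial>root_measure (pderiv (root_poly (\<lambda>i. Z i \<omega>) n))"
  show Fm: "?F n \<in> borel_measurable M" for n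
    using f measurable_Z by (rule measurable_integral_root_measure)
  fix \<epsilon> :: real assume \<epsilon>: "\<epsilon> > 0"
  define Off where "Off = {\<omega>\<in>space M. \<exists>i\<in>{1..}. norm (Z i \<omega>) \<noteq> 1}"
  define Small where "Small n = {\<omega>\<in>space M. norm (\<Sum>i=1..n. Z i \<omega>) < 1}" for n
  define Dev where "Dev n = {\<omega>\<in>space M.
      norm ((\<Sum>i=1..n. f (Z i \<omega>)) / of_nat n - (\<integral>x. f x \<partial>\<mu>)) \<ge> \<epsilon> / 2}" for n
  have [measurable]: "Off \<in> events" "Small n \<in> events" "Dev n \<in> events" for n
    unfolding Off_def Small_def Dev_def by measurable
  have "AE \<omega> in M. \<forall>i\<in>{1..}. norm (Z i \<omega>) = 1"
    using AE_Z[OF assms(3)] by (subst AE_ball_countable) auto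
  hence "AE \<omega> in M. \<omega> \<notin> Off"
    by eventually_elim (auto simp: Off_def)
  hence Off0: "prob Off = 0" by (subst prob_eq_0) auto
  show "(\<lambda>n. prob {\<omega>\<in>space M. dist (?F n \<omega>) (\<integral>x. f x \<partial>\<mu>) > \<epsilon>}) \<longlonglongrightarrow> 0"
  proof (rule prob_mono_tendsto_0)
    show "Off \<union> (Small n \<union> Dev n) \<in> events" for n by measurable
    show "(\<lambda>n. prob (Off \<union> (Small n \<union> Dev n))) \<longlonglongrightarrow> 0"
    proof (rule tendsto_sandwich[OF _ _ tendsto_const])
      show "(\<lambda>n. prob Off + (prob (Small n) + prob (Dev n))) \<longlonglongrightarrow> 0"
        unfolding Small_def Dev_def Off0
        using tendsto_add[OF prob_small_sum_tendsto_0[OF assms(3)] weak_law[OF fm, of B "\<epsilon> / 2"]]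
          B \<epsilon> by simp
      show "eventually (\<lambda>n. prob (Off \<union> (Small n \<union> Dev n))
          \<le> prob Off + (prob (Small n) + prob (Dev n))) sequentially"
        by (intro always_eventually allI order.trans[OF measure_Un_le] add_left_mono measure_Un_le)
          measurable
    qed auto
    have "continuous_on (cball 0 1) f" using f by (rule continuous_on_subset) auto
    from critical_average_close_to_root_average[OF this, of "\<epsilon> / 2"] \<epsilon>
    have "eventually (\<lambda>n. \<forall>z y. critical_enum z n y \<longrightarrow> (\<forall>i\<in>{1..n}. norm (z i) = 1) \<longrightarrow>
           norm (\<Sum>i=1..n. z i) \<ge> 1 \<longrightarrow>
           norm ((\<Sum>j<n-1. f (y j)) / of_nat (n - 1) - (\<Sum>i=1..n. f (z i)) / of_nat n) \<le> \<epsilon> / 2)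
         sequentially" by simp
    moreover have "eventually (\<lambda>n::nat. n \<ge> 2) sequentially"
      by (rule eventually_ge_at_top)
    ultimately show "eventually (\<lambda>n. {\<omega>\<in>space M. dist (?F n \<omega>) (\<integral>x. f x \<partial>\<mu>) > \<epsilon>}
        \<subseteq> Off \<union> (Small n \<union> Dev n)) sequentially"
    proof eventually_elim
      case (elim n)
      show ?case
      proof (rule subsetI, rule ccontr)
        fix \<omega>
        assume far: "\<omega> \<in> {\<omega>\<in>space M. dist (?F n \<omega>) (\<integral>x. f x \<partial>\<mu>) > \<epsilon>}"
          and out: "\<omega> \<notin> Off \<union> (Small n \<union> Dev n)"
        have circle: "\<forall>i\<in>{1..n}. norm (Z i \<omega>) = 1" and big: "norm (\<Sum>i=1..n. Z i \<omega>) \<ge> 1"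
          and dev: "norm ((\<Sum>i=1..n. f (Z i \<omega>)) / of_nat n - (\<integral>x. f x \<partial>\<mu>)) < \<epsilon> / 2"
          using far out by (auto simp: Off_def Small_def Dev_def)
        have "n \<ge> 1" using elim(2) by simp
        then obtain y where y: "critical_enum (\<lambda>i. Z i \<omega>) n y"
          by (rule critical_enum_exists)
        have "?F n \<omega> = (\<Sum>j<n-1. f (y j)) / of_nat (n - 1)"
          using y elim(2) fm by (rule integral_critical_enum)
        moreover have "norm ((\<Sum>j<n-1. f (y j)) / of_nat (n - 1)
            - (\<Sum>i=1..n. f (Z i \<omega>)) / of_nat n) \<le> \<epsilon> / 2"
          using elim(1) y circle big by blast
        ultimately have "dist (?F n \<omega>) (\<integral>x. f x \<partial>\<mu>) < \<epsilon> / 2 + \<epsilon> / 2"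
          using dev dist_triangle[of "?F n \<omega>" "\<integral>x. f x \<partial>\<mu>" "(\<Sum>i=1..n. f (Z i \<omega>)) / of_nat n"]
          by (simp only: dist_norm)
        thus False using far by simp
      qed
    qed
  qed
qed

end
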